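(* Let $0<a<1$, $\phi_a(z)=az+(1-a)$, and let $f\in H^2$ be a non-zero eigenvector of $C_{\phi_a}$. Then: (1) the radial limit $f^*(1)$ exists and is finite and non-zero if and only if $f$ is a constant; (2) $f$ is analytic at the point $1$ if and only if $f(z)=K(1-z)^n$ for some integer $n\ge0$ and some scalar $K$.
   Context: $H^2=H^2(\mathbb{D})$ is the Hardy space of the open unit disk $\mathbb{D}$, and $C_{\phi_a}f=f\circ\phi_a$. The radial limit at $1$ is $f^*(1)=\lim_{r\to1^-}f(r)$, if it exists. "Analytic at $1$" means that $f$ extends analytically to a neighbourhood of $1$. *)

theory Defs
  imports "HOL-Complex_Analysis.Complex_Analysis"
begin

text \<open>
  Functions on the open unit disk are represented by total functions \<open>complex \<Rightarrow> complex\<close>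
  whose values outside \<open>ball 0 1\<close> are irrelevant; all (in)equalities between such functions
  are therefore stated on \<open>ball 0 1\<close> only.
\<close>

definition hardy2 :: "(complex \<Rightarrow> complex) set" where
  "hardy2 = {f. f holomorphic_on ball 0 1 \<and>
     bdd_above ((\<lambda>r. 1 / (2 * pi) *
        integral {0..2 * pi} (\<lambda>t. (cmod (f (complex_of_real r * cis t)))\<^sup>2)) ` {0..<1})}"

definition phi :: "real \<Rightarrow> complex \<Rightarrow> complex" where
  "phi a z = complex_of_real a * z + (1 - complex_of_real a)"

definition composition_op :: "(complex \<Rightarrow> complex) \<Rightarrow> (complex \<Rightarrow> complex) \<Rightarrow> (complex \<Rightarrow> complex)" where
  "composition_op \<phi> f = f \<circ> \<phi>"

definition hardy2_eigenvector ::
    "((complex \<Rightarrow> complex) \<Rightarrow> (complex \<Rightarrow> complex)) \<Rightarrow> (complex \<Rightarrow> complex) \<Rightarrow> bool" where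
  "hardy2_eigenvector T f \<longleftrightarrow>
     f \<in> hardy2 \<and> (\<exists>z\<in>ball 0 1. f z \<noteq> 0) \<and> (\<exists>\<mu>::complex. \<forall>z\<in>ball 0 1. T f z = \<mu> * f z)"

definition has_radial_limit :: "(complex \<Rightarrow> complex) \<Rightarrow> complex \<Rightarrow> complex \<Rightarrow> bool" where
  "has_radial_limit f \<zeta> L \<longleftrightarrow> ((\<lambda>r. f (complex_of_real r * \<zeta>)) \<longlongrightarrow> L) (at_left 1)"

text \<open>
  For a boundary point \<open>\<zeta>\<close> the library predicate \<open>f analytic_on {\<zeta>}\<close> would constrain the
  irrelevant values of \<open>f\<close> outside the disk, so analyticity is expressed by an extension \<open>g\<close>.
\<close>

definition analytic_at_boundary :: "(complex \<Rightarrow> complex) \<Rightarrow> complex \<Rightarrow> bool" where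
  "analytic_at_boundary f \<zeta> \<longleftrightarrow>
     (\<exists>U g. open U \<and> \<zeta> \<in> U \<and> g holomorphic_on U \<and> (\<forall>z\<in>U \<inter> ball 0 1. g z = f z))"

end

theory Submission
  imports Defs
begin

text \<open>
  The map \<open>\<phi>\<^sub>a\<close> contracts the plane towards its fixed point 1 by the factor \<open>a\<close>:
  \<open>1 - \<phi>\<^sub>a z = a (1 - z)\<close>. So the orbit of a point \<open>r\<close> of \<open>(0, 1)\<close> runs along the radius to 1.
  If \<open>f \<circ> \<phi>\<^sub>a = \<mu> f\<close> and the radial limit of \<open>f\<close> at 1 is \<open>L \<noteq> 0\<close>, then letting \<open>r \<rightarrow> 1\<close> in
  \<open>f(\<phi>\<^sub>a r) = \<mu> f(r)\<close> gives \<open>L = \<mu> L\<close>, so \<open>\<mu> = 1\<close>. Hence \<open>f\<close> is constant along the orbit of \<open>r\<close>,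
  and as the orbit tends to 1, that constant is \<open>L\<close>. The identity theorem extends \<open>f = L\<close> from
  the radius to the disk (\<open>eigenfunction_constant_if_radial_limit\<close>).

  The claim on analyticity reduces to this one. If \<open>f\<close> extends analytically to 1, with a zero of
  order \<open>n \<ge> 0\<close> there, then \<open>f(z) / (1 - z)\<^sup>n\<close> is again an eigenfunction of composition with
  \<open>\<phi>\<^sub>a\<close>, now with eigenvalue \<open>\<mu> / a\<^sup>n\<close>, and its radial limit at 1 is finite and non-zero
  (\<open>nonzero_radial_limit_after_dividing_out_zero\<close>). It is therefore a constant \<open>K\<close>, that is,
  \<open>f(z) = K (1 - z)\<^sup>n\<close>.
\<close>

lemma one_minus_phi: "1 - phi a z = of_real a * (1 - z)"
  by (simp add: phi_def algebra_simps)

lemma phi_of_real: "phi a (of_real r) = of_real (1 - a * (1 - r))"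
  by (simp add: phi_def algebra_simps)

lemma eq_on_disk_if_eq_on_real_segment:
  fixes f g :: "complex \<Rightarrow> complex"
  assumes "f holomorphic_on ball 0 1" "g holomorphic_on ball 0 1"
    and eq: "\<And>r. 0 < r \<Longrightarrow> r < 1 \<Longrightarrow> f (of_real r) = g (of_real r)"
    and z: "z \<in> ball 0 1"
  shows "f z = g z"
proof -
  let ?U = "of_real ` {0<..<1::real} :: complex set"
  have "(0::complex) islimpt ?U"
    unfolding islimpt_approachable
  proof (intro allI impI)
    fix e :: real assume "e > 0"
    then have "of_real (min (e/2) (1/2)) \<in> ?U" "dist (of_real (min (e/2) (1/2))) (0::complex) < e"
      by (auto simp del: of_real_divide)
    with \<open>e > 0\<close> show "\<exists>x'\<in>?U. x' \<noteq> 0 \<and> dist x' 0 < e"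
      by (intro bexI[of _ "of_real (min (e/2) (1/2))"]) (auto simp del: of_real_divide)
  qed
  then have "f z - g z = 0"
    using assms
    by (intro analytic_continuation[of "\<lambda>z. f z - g z" "ball 0 1" ?U 0 z])
       (auto intro!: holomorphic_intros)
  then show ?thesis by simp
qed

text \<open>
  A non-zero radial limit leaves 1 as the only possible eigenvalue, and invariance under a
  contraction towards 1 lets the behaviour near 1 determine the function on the whole radius.
  The eigenvalue is left arbitrary so that the lemma also applies after division by \<open>(1 - z)\<^sup>n\<close>.
\<close>

lemma eigenfunction_constant_if_radial_limit:
  assumes a: "0 < a" "a < 1"
    and hol: "f holomorphic_on ball 0 1"
    and eig: "\<And>z. z \<in> ball 0 1 \<Longrightarrow> f (phi a z) = \<mu> * f z"
    and lim: "has_radial_limit f 1 L" and "L \<noteq> 0"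
    and z: "z \<in> ball 0 1"
  shows "f z = L"
proof -
  have lim': "((\<lambda>r. f (of_real r)) \<longlongrightarrow> L) (at_left (1::real))"
    using lim by (simp add: has_radial_limit_def)
  have eig_real: "f (of_real (1 - a * (1 - r))) = \<mu> * f (of_real r)" if "0 < r" "r < 1" for r
    using eig[of "of_real r"] that by (simp only: phi_of_real) simp
  have "filterlim (\<lambda>r. 1 - a * (1 - r)) (at_left 1) (at_left (1::real))"
    using a by real_asymp
  then have "((\<lambda>r. f (of_real (1 - a * (1 - r)))) \<longlongrightarrow> L) (at_left 1)"
    by (rule filterlim_compose[OF lim'])
  moreover have "eventually (\<lambda>r. f (of_real (1 - a * (1 - r))) = \<mu> * f (of_real r)) (at_left 1)"
    using eventually_at_left_real[of 0 1] eig_real by (auto elim!: eventually_mono)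
  ultimately have "((\<lambda>r. \<mu> * f (of_real r)) \<longlongrightarrow> L) (at_left (1::real))"
    by (rule Lim_transform_eventually)
  then have "\<mu> * L = L"
    using tendsto_mult_left[OF lim', of \<mu>] tendsto_unique trivial_limit_at_left_real by blast
  with \<open>L \<noteq> 0\<close> have "\<mu> = 1" by simp
  have "f (of_real r) = L" if r: "0 < r" "r < 1" for r
  proof -
    have orbit: "f (of_real (1 - a ^ k * (1 - r))) = f (of_real r)" for k
    proof (induction k)
      case (Suc k)
      have "a ^ k * (1 - r) \<le> 1 - r"
        using a r mult_right_mono[of "a ^ k" 1 "1 - r"] by (simp add: power_le_one)
      then have "0 < 1 - a ^ k * (1 - r)" "1 - a ^ k * (1 - r) < 1"
        using a r by (linarith, simp)
      from eig_real[OF this] Suc show ?case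
        by (simp add: \<open>\<mu> = 1\<close> mult.assoc)
    qed simp
    have "(\<lambda>k. 1 - a ^ k * (1 - r)) \<longlonglongrightarrow> 1 - 0 * (1 - r)"
      using a by (intro tendsto_intros LIMSEQ_power_zero) auto
    then have "filterlim (\<lambda>k. 1 - a ^ k * (1 - r)) (at_left 1) sequentially"
      using a r by (auto simp: filterlim_at)
    then have "(\<lambda>k. f (of_real (1 - a ^ k * (1 - r)))) \<longlonglongrightarrow> L"
      by (rule filterlim_compose[OF lim'])
    then show ?thesis
      by (simp only: orbit) (simp add: LIMSEQ_const_iff)
  qed
  then show ?thesis
    using eq_on_disk_if_eq_on_real_segment[OF hol _ _ z, of "\<lambda>_. L"] by simp
qed

text \<open>
  Near 1 the extension of \<open>f\<close> is \<open>h(z) (z - 1)\<^sup>n\<close> with \<open>h\<close> continuous and \<open>h(1) \<noteq> 0\<close>, so the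
  quotient by \<open>(1 - z)\<^sup>n\<close> tends to \<open>(-1)\<^sup>n h(1)\<close>.
\<close>

lemma nonzero_radial_limit_after_dividing_out_zero:
  assumes hol: "f holomorphic_on ball 0 1"
    and nz: "\<exists>z\<in>ball 0 1. f z \<noteq> 0"
    and an: "analytic_at_boundary f 1"
  obtains n L where "has_radial_limit (\<lambda>z. f z / (1 - z) ^ n) 1 L" "L \<noteq> 0"
proof -
  obtain U g where U: "open U" "1 \<in> U" "g holomorphic_on U"
    and gf: "\<And>z. z \<in> U \<Longrightarrow> z \<in> ball 0 1 \<Longrightarrow> g z = f z"
    using an unfolding analytic_at_boundary_def by blast
  obtain e where e: "e > 0" "ball 1 e \<subseteq> U"
    using U by (auto simp: open_contains_ball)
  have in_balls: "of_real r \<in> ball (1::complex) d \<and> of_real r \<in> ball (0::complex) 1"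
    if "max 0 (1 - d) < r" "r < 1" for r d :: real
  proof -
    have "dist 1 (complex_of_real r) = 1 - r"
      using that dist_of_real[of 1 r, where ?'a = complex] by (simp add: dist_real_def)
    with that show ?thesis by auto
  qed
  have near_one: "eventually (\<lambda>r. of_real r \<in> ball (1::complex) d \<and> of_real r \<in> ball (0::complex) 1)
      (at_left (1::real))" if "d > 0" for d
  proof (rule eventually_mono)
    show "eventually (\<lambda>r. r \<in> {max 0 (1 - d)<..<1}) (at_left 1)"
      using that by (intro eventually_at_left_real) simp
  qed (rule in_balls; simp)
  \<comment> \<open>The zero of \<open>g\<close> at 1 has finite order: otherwise \<open>f\<close> would vanish on the part of the disk
    near 1, hence everywhere.\<close>
  have g_nz: "\<exists>w\<in>ball 1 e. g w \<noteq> 0"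
  proof (rule ccontr)
    assume "\<not> ?thesis"
    then have zero: "f z = 0" if "z \<in> ball 1 e" "z \<in> ball 0 1" for z
      using gf[of z] e that by auto
    obtain r :: real where r: "of_real r \<in> ball (1::complex) e" "of_real r \<in> ball (0::complex) 1"
      using eventually_happens'[OF trivial_limit_at_left_real near_one[OF e(1)]] by blast
    then have "ball 1 e \<inter> ball 0 1 \<noteq> ({} :: complex set)" by blast
    then have "f z = 0" if "z \<in> ball 0 1" for z
      using analytic_continuation_open[of "ball 1 e \<inter> ball 0 1" "ball 0 1" f "\<lambda>_. 0" z] hol that zero
      by (simp add: open_Int)
    with nz show False by auto
  qed
  have g_hol: "g holomorphic_on ball 1 e" and one: "1 \<in> ball (1::complex) e"
    using holomorphic_on_subset[OF U(3) e(2)] e(1) by auto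
  obtain d where d: "0 < d" "cball (1::complex) d \<subseteq> ball 1 e"
    and h_hol: "zor_poly g 1 holomorphic_on cball 1 d"
    and gh: "\<forall>w\<in>cball 1 d. g w = zor_poly g 1 w * (w - 1) ^ nat (zorder g 1) \<and> zor_poly g 1 w \<noteq> 0"
    using zorder_exist_zero[OF g_hol open_ball connected_ball one g_nz, THEN conjunct2]
    by (elim exE conjE) (rule that)
  define h where "h = zor_poly g 1"
  have h: "h holomorphic_on cball 1 d" "h 1 \<noteq> 0"
    using h_hol bspec[OF gh, of 1] d(1) by (simp_all add: h_def)
  define n where "n = nat (zorder g 1)"
  have quotient: "(- 1) ^ n * h z = f z / (1 - z) ^ n" if "z \<in> ball 1 d" "z \<in> ball 0 1" for z
  proof -
    have "z \<noteq> 1" using that by auto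
    moreover have "z \<in> cball 1 d" using that(1) by simp
    then have "z \<in> U" using d(2) e(2) by blast
    then have "f z = h z * ((- 1) * (1 - z)) ^ n"
      using gf[of z] bspec[OF gh \<open>z \<in> cball 1 d\<close>] that(2) by (simp add: n_def h_def)
    ultimately show ?thesis
      unfolding power_mult_distrib by (simp add: field_simps)
  qed
  have "isCont h 1"
    using continuous_on_interior[OF holomorphic_on_imp_continuous_on[OF h(1)], of 1] d(1)
    by (simp add: interior_cball)
  then have "((\<lambda>r. h (of_real r)) \<longlongrightarrow> h (of_real 1)) (at_left (1::real))"
    by (intro isCont_tendsto_compose[of _ h] tendsto_intros) auto
  then have "((\<lambda>r. (- 1) ^ n * h (of_real r)) \<longlongrightarrow> (- 1) ^ n * h 1) (at_left (1::real))"
    by (intro tendsto_intros) auto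
  then have "((\<lambda>r. f (of_real r) / (1 - of_real r) ^ n) \<longlongrightarrow> (- 1) ^ n * h 1) (at_left (1::real))"
    by (rule Lim_transform_eventually)
       (use near_one[OF d(1)] quotient in \<open>auto elim!: eventually_mono\<close>)
  then show thesis
    using that[of n "(- 1) ^ n * h 1"] h(2) by (simp add: has_radial_limit_def)
qed

theorem theorem22:
  fixes a :: real and f :: "complex \<Rightarrow> complex"
  assumes "0 < a" and "a < 1"
    and "hardy2_eigenvector (composition_op (phi a)) f"
  shows "((\<exists>L. has_radial_limit f 1 L \<and> L \<noteq> 0) \<longleftrightarrow> f constant_on ball 0 1) \<and>
    (analytic_at_boundary f 1 \<longleftrightarrow> (\<exists>(n::nat) (K::complex). \<forall>z\<in>ball 0 1. f z = K * (1 - z) ^ n))"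
proof -
  obtain \<mu> where hol: "f holomorphic_on ball 0 1" and nz: "\<exists>z\<in>ball 0 1. f z \<noteq> 0"
    and eig: "\<And>z. z \<in> ball 0 1 \<Longrightarrow> f (phi a z) = \<mu> * f z"
    using assms(3) unfolding hardy2_eigenvector_def hardy2_def composition_op_def o_apply
    by blast
  have "f constant_on ball 0 1" if "has_radial_limit f 1 L" "L \<noteq> 0" for L
    using eigenfunction_constant_if_radial_limit[OF assms(1,2) hol eig that]
    unfolding constant_on_def by blast
  moreover have "\<exists>L. has_radial_limit f 1 L \<and> L \<noteq> 0" if "f constant_on ball 0 1"
  proof -
    from that nz obtain c where c: "\<And>z. z \<in> ball 0 1 \<Longrightarrow> f z = c" "c \<noteq> 0"
      unfolding constant_on_def by metis
    have "eventually (\<lambda>r. c = f (of_real r)) (at_left (1::real))"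
      using eventually_at_left_real[of 0 1] c by (auto elim!: eventually_mono)
    then have "((\<lambda>r. f (of_real r)) \<longlongrightarrow> c) (at_left (1::real))"
      by (rule Lim_transform_eventually[OF tendsto_const])
    with c show ?thesis by (auto simp: has_radial_limit_def)
  qed
  moreover have "\<exists>n K. \<forall>z\<in>ball 0 1. f z = K * (1 - z) ^ n" if an: "analytic_at_boundary f 1"
  proof -
    obtain n K where K: "has_radial_limit (\<lambda>z. f z / (1 - z) ^ n) 1 K" "K \<noteq> 0"
      using nonzero_radial_limit_after_dividing_out_zero[OF hol nz an] .
    have "(\<lambda>z. f z / (1 - z) ^ n) holomorphic_on ball 0 1"
      by (intro holomorphic_intros hol) auto
    moreover have "f (phi a z) / (1 - phi a z) ^ n = (\<mu> / of_real a ^ n) * (f z / (1 - z) ^ n)"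
      if "z \<in> ball 0 1" for z
      using eig[OF that] by (simp add: one_minus_phi power_mult_distrib)
    ultimately have "f z / (1 - z) ^ n = K" if "z \<in> ball 0 1" for z
      using eigenfunction_constant_if_radial_limit[OF assms(1,2) _ _ K that] by blast
    moreover have "(1 - z) ^ n \<noteq> 0" if "z \<in> ball 0 1" for z :: complex
      using that by auto
    ultimately have "f z = K * (1 - z) ^ n" if "z \<in> ball 0 1" for z
      using that by (metis nonzero_divide_eq_eq)
    then show ?thesis by blast
  qed
  moreover have "analytic_at_boundary f 1" if "\<forall>z\<in>ball 0 1. f z = K * (1 - z) ^ n" for n K
    unfolding analytic_at_boundary_def using that
    by (intro exI[of _ UNIV] exI[of _ "\<lambda>z. K * (1 - z) ^ n"]) (auto intro!: holomorphic_intros)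
  ultimately show ?thesis by blast
qed

end
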